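(* If a graph $H$ contains an induced cycle of length at least $5$, then the class of $H$-subdivisions does not have the induced Erdős–Pósa property.
   Context: All graphs are finite and simple. A subdivision of $H$ is a graph obtained from $H$ by repeatedly replacing an edge by a path of length $2$ through a new vertex. An induced subdivision of $H$ in $G$ is an induced subgraph of $G$ isomorphic to a subdivision of $H$. The class of $H$-subdivisions has the induced Erdős–Pósa property if there is a function $f:\mathbb N\to\mathbb R$ such that for every graph $G$ and every positive integer $k$, $G$ contains either $k$ pairwise vertex-disjoint induced subdivisions of $H$ or a set of at most $f(k)$ vertices meeting every induced subdivision of $H$. *)

theory Defs
  imports Complex_Main
begin

type_synonym 'a graph = "'a set \<times> 'a set set"

definition verts :: "'a graph \<Rightarrow> 'a set" where "verts G = fst G"
definition edges :: "'a graph \<Rightarrow> 'a set set" where "edges G = snd G"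

definition wf_graph :: "'a graph \<Rightarrow> bool" where
  "wf_graph G \<longleftrightarrow> finite (verts G) \<and> (\<forall>e\<in>edges G. e \<subseteq> verts G \<and> card e = 2)"

definition induced_subgraph :: "'a graph \<Rightarrow> 'a set \<Rightarrow> 'a graph" where
  "induced_subgraph G S = (S, {e \<in> edges G. e \<subseteq> S})"

definition graph_iso :: "'a graph \<Rightarrow> 'b graph \<Rightarrow> bool" where
  "graph_iso G H \<longleftrightarrow> (\<exists>f. bij_betw f (verts G) (verts H) \<and>
      (\<forall>x\<in>verts G. \<forall>y\<in>verts G. {x, y} \<in> edges G \<longleftrightarrow> {f x, f y} \<in> edges H))"

inductive subdivision_of :: "'a graph \<Rightarrow> ('a + nat) graph \<Rightarrow> bool" for H where
  base: "subdivision_of H (Inl ` verts H, (\<lambda>e. Inl ` e) ` edges H)"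
| step: "subdivision_of H (V, E) \<Longrightarrow> {x, y} \<in> E \<Longrightarrow> z \<notin> V \<Longrightarrow>
         subdivision_of H (insert z V, (E - {{x, y}}) \<union> {{x, z}, {z, y}})"

definition induced_subdivision :: "'a graph \<Rightarrow> 'b graph \<Rightarrow> 'b set \<Rightarrow> bool" where
  "induced_subdivision H G S \<longleftrightarrow> S \<subseteq> verts G \<and>
     (\<exists>H'. subdivision_of H H' \<and> graph_iso (induced_subgraph G S) H')"

text \<open>Induced Erdos-Posa property; "every graph G" ranges over finite graphs with
natural-number vertices (every finite graph is isomorphic to one).\<close>
definition induced_EP_property :: "'a graph \<Rightarrow> bool" where
  "induced_EP_property H \<longleftrightarrow> (\<exists>f :: nat \<Rightarrow> real. \<forall>(G :: nat graph) k. wf_graph G \<longrightarrow> k > 0 \<longrightarrow>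
      (\<exists>S :: nat \<Rightarrow> nat set. (\<forall>i<k. induced_subdivision H G (S i)) \<and>
          (\<forall>i<k. \<forall>j<k. i \<noteq> j \<longrightarrow> S i \<inter> S j = {}))
    \<or> (\<exists>X. X \<subseteq> verts G \<and> real (card X) \<le> f k \<and>
          (\<forall>S. induced_subdivision H G S \<longrightarrow> S \<inter> X \<noteq> {})))"

definition cycle_graph :: "nat \<Rightarrow> nat graph" where
  "cycle_graph n = ({..<n}, {{i, Suc i mod n} | i. i < n})"

definition has_induced_cycle_of_length :: "'a graph \<Rightarrow> nat \<Rightarrow> bool" where
  "has_induced_cycle_of_length H n \<longleftrightarrow>
     (\<exists>S \<subseteq> verts H. graph_iso (induced_subgraph H S) (cycle_graph n))"

end

theory Submission
  imports Defs "HOL-Library.Disjoint_Sets" "HOL-Library.Nat_Bijection" "HOL-Number_Theory.Cong"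
begin

text \<open>
  Subdivide every edge of \<open>H\<close> the same large number \<open>2 * n\<close> of times. Take \<open>n\<close> copies of
  this subdivision and let any two of them share one crossing vertex on each subdivided edge, so
  that crossing vertices are never adjacent within a copy. Finally join two vertices that lie in
  no common copy unless both are crossing vertices. Every copy remains an induced subdivision of
  \<open>H\<close>, and since a vertex lies in at most two copies, fewer than \<open>n / 2\<close> vertices cannot meet
  all copies.

  Every induced subdivision of \<open>H\<close> contains an induced cycle of length at least five, and in
  the new graph such a cycle lies inside a single copy. Indeed, if \<open>i\<close> is the only copy
  containing some vertex of the cycle, then the vertices of the cycle that lie in copy \<open>i\<close> only
  are joined to all those outside copy \<open>i\<close>, and the remaining ones are crossing vertices, hence
  independent; minimum degree two and girth five exclude this unless nothing lies outside copy
  \<open>i\<close>. The cycle therefore runs through one whole subdivided edge of copy \<open>i\<close>. If \<open>H\<close> has \<open>q\<close>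
  edges, then among \<open>q + 1\<close> induced subdivisions two run through the same edge of \<open>H\<close>, in
  copies \<open>i\<close> and \<open>j\<close>, and so they share the crossing vertex of \<open>i\<close> and \<open>j\<close> on it, or the
  whole subdivided edge if \<open>i = j\<close>.
\<close>

section \<open>Induced embeddings\<close>

definition adj :: "'a graph \<Rightarrow> 'a \<Rightarrow> 'a \<Rightarrow> bool" where
  "adj G x y \<longleftrightarrow> {x, y} \<in> edges G"

lemma adj_commute: "adj G x y \<longleftrightarrow> adj G y x"
  by (simp add: adj_def insert_commute)

lemma wf_graph_adjD:
  assumes "wf_graph G" "adj G x y"
  shows "x \<noteq> y" "x \<in> verts G" "y \<in> verts G"
  using assms by (auto simp: wf_graph_def adj_def card_2_iff)

definition induced_embedding :: "('a \<Rightarrow> 'b) \<Rightarrow> 'a graph \<Rightarrow> 'b graph \<Rightarrow> bool" where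
  "induced_embedding f G K \<longleftrightarrow> inj_on f (verts G) \<and> f ` verts G \<subseteq> verts K \<and>
     (\<forall>x\<in>verts G. \<forall>y\<in>verts G. adj K (f x) (f y) \<longleftrightarrow> adj G x y)"

lemma induced_embeddingD:
  assumes "induced_embedding f G K"
  shows "inj_on f (verts G)" "f ` verts G \<subseteq> verts K"
    and "\<And>x y. \<lbrakk>x \<in> verts G; y \<in> verts G\<rbrakk> \<Longrightarrow> adj K (f x) (f y) \<longleftrightarrow> adj G x y"
    and "\<And>x y. \<lbrakk>x \<in> verts G; y \<in> verts G\<rbrakk> \<Longrightarrow> f x = f y \<longleftrightarrow> x = y"
  using assms by (auto simp: induced_embedding_def dest: inj_onD)

lemma induced_embedding_comp:
  assumes "induced_embedding f G K" "induced_embedding g K L"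
  shows "induced_embedding (g \<circ> f) G L"
  using assms inj_on_subset[of g "verts K" "f ` verts G"]
  by (auto simp: induced_embedding_def image_subset_iff intro: comp_inj_on)

lemma induced_embedding_inv_into:
  assumes f: "induced_embedding f G K" and onto: "f ` verts G = verts K"
  shows "induced_embedding (inv_into (verts G) f) K G"
    and "inv_into (verts G) f ` verts K = verts G"
proof -
  let ?g = "inv_into (verts G) f"
  have bij: "bij_betw ?g (verts K) (verts G)"
    using induced_embeddingD(1)[OF f] onto by (intro bij_betw_inv_into) (simp add: bij_betw_def)
  then show "?g ` verts K = verts G" by (simp add: bij_betw_def)
  have "adj G (?g x) (?g y) \<longleftrightarrow> adj K x y" if "x \<in> verts K" "y \<in> verts K" for x y
    using that induced_embeddingD(3)[OF f, of "?g x" "?g y"] unfolding onto[symmetric]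
    by (simp add: inv_into_into f_inv_into_f)
  then show "induced_embedding ?g K G"
    using bij by (simp add: induced_embedding_def bij_betw_def)
qed

lemma graph_iso_iff_induced_embedding:
  "graph_iso G K \<longleftrightarrow> (\<exists>f. induced_embedding f G K \<and> f ` verts G = verts K)"
  by (auto simp: graph_iso_def induced_embedding_def bij_betw_def adj_def)

lemma graph_iso_commute: "graph_iso G K \<longleftrightarrow> graph_iso K G"
  unfolding graph_iso_iff_induced_embedding using induced_embedding_inv_into by metis

lemma graph_iso_induced_subgraph_iff:
  assumes "S \<subseteq> verts G"
  shows "graph_iso (induced_subgraph G S) K \<longleftrightarrow> (\<exists>f. induced_embedding f K G \<and> f ` verts K = S)"
proof -
  have V: "verts (induced_subgraph G S) = S"
    by (simp add: induced_subgraph_def verts_def)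
  have "adj (induced_subgraph G S) x y \<longleftrightarrow> adj G x y" if "x \<in> S" "y \<in> S" for x y
    using that by (simp add: induced_subgraph_def adj_def edges_def)
  then have "induced_embedding f K (induced_subgraph G S) \<longleftrightarrow> induced_embedding f K G"
    if "f ` verts K = S" for f
    using that assms by (auto simp: induced_embedding_def V)
  then have "graph_iso K (induced_subgraph G S) \<longleftrightarrow> (\<exists>f. induced_embedding f K G \<and> f ` verts K = S)"
    by (auto simp: graph_iso_iff_induced_embedding V)
  then show ?thesis by (simp only: graph_iso_commute[of "induced_subgraph G S"])
qed

lemma has_induced_cycle_of_length_iff:
  "has_induced_cycle_of_length G n \<longleftrightarrow> (\<exists>f. induced_embedding f (cycle_graph n) G)"
  unfolding has_induced_cycle_of_length_def
  by (metis graph_iso_induced_subgraph_iff induced_embeddingD(2))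

lemma induced_subdivision_iff:
  "induced_subdivision H G S \<longleftrightarrow>
     (\<exists>K f. subdivision_of H K \<and> induced_embedding f K G \<and> f ` verts K = S)"
  unfolding induced_subdivision_def
  by (metis graph_iso_induced_subgraph_iff induced_embeddingD(2))

lemma induced_subdivision_image:
  assumes "induced_subdivision H G S" "induced_embedding g G G'"
  shows "induced_subdivision H G' (g ` S)"
proof -
  obtain K f where K: "subdivision_of H K" "induced_embedding f K G" "f ` verts K = S"
    using assms(1) by (auto simp: induced_subdivision_iff)
  have "induced_embedding (g \<circ> f) K G'" "(g \<circ> f) ` verts K = g ` S"
    using induced_embedding_comp[OF K(2) assms(2)] K(3) by auto
  then show ?thesis using K(1) unfolding induced_subdivision_iff by blast
qed

definition map_graph :: "('a \<Rightarrow> 'b) \<Rightarrow> 'a graph \<Rightarrow> 'b graph" where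
  "map_graph g G = (g ` verts G, (`) g ` edges G)"

lemma verts_map_graph: "verts (map_graph g G) = g ` verts G"
  by (simp add: map_graph_def verts_def)

lemma wf_graph_map_graph:
  assumes "wf_graph G" "inj_on g (verts G)"
  shows "wf_graph (map_graph g G)"
proof -
  have "card (g ` e) = 2" if "e \<in> edges G" for e
    using that assms card_image[of g e] inj_on_subset[of g "verts G" e]
    by (simp add: wf_graph_def)
  then show ?thesis using assms by (auto simp: wf_graph_def map_graph_def verts_def edges_def)
qed

lemma induced_embedding_map_graph:
  assumes "wf_graph G" "inj_on g (verts G)"
  shows "induced_embedding g G (map_graph g G)"
proof -
  have "adj (map_graph g G) (g x) (g y) \<longleftrightarrow> adj G x y" if "x \<in> verts G" "y \<in> verts G" for x y
  proof -
    have "g ` {x, y} = g ` e \<longleftrightarrow> {x, y} = e" if "e \<in> edges G" for e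
      using that assms \<open>x \<in> verts G\<close> \<open>y \<in> verts G\<close>
      by (intro inj_on_image_eq_iff) (auto simp: wf_graph_def)
    then show ?thesis by (auto simp: adj_def map_graph_def edges_def)
  qed
  then show ?thesis using assms(2) by (simp add: induced_embedding_def verts_map_graph)
qed

definition graph_of_rel :: "'a set \<Rightarrow> ('a \<Rightarrow> 'a \<Rightarrow> bool) \<Rightarrow> 'a graph" where
  "graph_of_rel V R = (V, {{x, y} | x y. x \<in> V \<and> y \<in> V \<and> R x y})"

lemma verts_graph_of_rel: "verts (graph_of_rel V R) = V"
  by (simp add: graph_of_rel_def verts_def)

lemma adj_graph_of_rel_iff:
  assumes "symp R"
  shows "adj (graph_of_rel V R) x y \<longleftrightarrow> x \<in> V \<and> y \<in> V \<and> R x y"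
  using sympD[OF assms] by (auto simp: graph_of_rel_def adj_def edges_def doubleton_eq_iff)

lemma wf_graph_graph_of_rel:
  assumes "finite V" "irreflp_on V R"
  shows "wf_graph (graph_of_rel V R)"
proof -
  have "card {x, y} = 2" if "x \<in> V" "R x y" for x y
    using assms(2) that by (cases "x = y") (auto simp: irreflp_on_def)
  then show ?thesis using assms(1) by (auto simp: graph_of_rel_def wf_graph_def verts_def edges_def)
qed

section \<open>Packings and hitting sets\<close>

definition has_packing :: "'a graph \<Rightarrow> nat \<Rightarrow> 'b graph \<Rightarrow> bool" where
  "has_packing H k G \<longleftrightarrow> (\<exists>S. (\<forall>i<k. induced_subdivision H G (S i)) \<and>
     disjoint_family_on S {..<k})"

definition hitting_set :: "'a graph \<Rightarrow> 'b graph \<Rightarrow> 'b set \<Rightarrow> bool" where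
  "hitting_set H G X \<longleftrightarrow> X \<subseteq> verts G \<and> (\<forall>S. induced_subdivision H G S \<longrightarrow> S \<inter> X \<noteq> {})"

lemma has_packing_induced_embedding:
  assumes "has_packing H k G" "induced_embedding g G G'"
  shows "has_packing H k G'"
proof -
  obtain S where S: "\<And>i. i < k \<Longrightarrow> induced_subdivision H G (S i)"
    and disjoint: "disjoint_family_on S {..<k}"
    using assms(1) unfolding has_packing_def by blast
  have "disjoint_family_on (\<lambda>i. g ` S i) {..<k}"
    unfolding disjoint_family_on_def
  proof (intro ballI impI)
    fix i j
    assume ij: "i \<in> {..<k}" "j \<in> {..<k}" "i \<noteq> j"
    then have "S i \<subseteq> verts G" "S j \<subseteq> verts G"
      using S by (auto simp: induced_subdivision_def)
    then show "g ` S i \<inter> g ` S j = {}"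
      using disjoint_family_onD[OF disjoint ij]
        inj_on_image_Int[OF induced_embeddingD(1)[OF assms(2)]]
      by (metis image_empty)
  qed
  moreover have "induced_subdivision H G' (g ` S i)" if "i < k" for i
    using S[OF that] assms(2) by (rule induced_subdivision_image)
  ultimately show ?thesis
    unfolding has_packing_def by (intro exI[of _ "\<lambda>i. g ` S i"]) simp
qed

lemma hitting_set_induced_embedding:
  assumes "hitting_set H G' X" "induced_embedding g G G'"
  shows "hitting_set H G {x \<in> verts G. g x \<in> X}"
  unfolding hitting_set_def
proof (intro conjI allI impI)
  fix S
  assume S: "induced_subdivision H G S"
  have "g ` S \<inter> X \<noteq> {}"
    using assms(1) induced_subdivision_image[OF S assms(2)] by (simp add: hitting_set_def)
  moreover have "S \<subseteq> verts G" using S by (simp add: induced_subdivision_def)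
  ultimately show "S \<inter> {x \<in> verts G. g x \<in> X} \<noteq> {}" by blast
qed blast

lemma wf_graph_iso_nat_graph:
  assumes "wf_graph G"
  obtains M :: "nat graph" where "wf_graph M" "graph_iso G M"
proof -
  obtain g :: "'a \<Rightarrow> nat" where g: "inj_on g (verts G)"
    using assms finite_imp_inj_to_nat_seg[of "verts G"] by (auto simp: wf_graph_def)
  have "graph_iso G (map_graph g G)"
    using induced_embedding_map_graph[OF assms g]
    by (auto simp: graph_iso_iff_induced_embedding verts_map_graph)
  then show ?thesis using that wf_graph_map_graph[OF assms g] by blast
qed

lemma induced_EP_property_iff:
  "induced_EP_property H \<longleftrightarrow> (\<exists>f :: nat \<Rightarrow> real. \<forall>(G :: nat graph) k. wf_graph G \<longrightarrow> k > 0 \<longrightarrow>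
     has_packing H k G \<or> (\<exists>X. hitting_set H G X \<and> real (card X) \<le> f k))"
  by (simp only: induced_EP_property_def has_packing_def hitting_set_def
      disjoint_family_on_def Ball_def lessThan_iff conj_ac)

lemma induced_EP_property_bound:
  fixes H :: "'a graph"
  assumes "induced_EP_property H" "k > 0"
  obtains N where "\<And>G :: 'b graph. wf_graph G \<Longrightarrow>
    has_packing H k G \<or> (\<exists>X. hitting_set H G X \<and> card X \<le> N)"
proof -
  obtain f :: "nat \<Rightarrow> real" where f: "\<And>M :: nat graph. wf_graph M \<Longrightarrow>
      has_packing H k M \<or> (\<exists>X. hitting_set H M X \<and> real (card X) \<le> f k)"
    using assms unfolding induced_EP_property_iff by blast
  have "has_packing H k G \<or> (\<exists>X. hitting_set H G X \<and> card X \<le> nat \<lfloor>f k\<rfloor>)"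
    if wf: "wf_graph G" for G :: "'b graph"
  proof -
    obtain M :: "nat graph" where M: "wf_graph M" "graph_iso G M"
      using wf_graph_iso_nat_graph[OF wf] .
    obtain g h where g: "induced_embedding g G M" and h: "induced_embedding h M G"
      using M(2) graph_iso_commute[of G M] by (auto simp: graph_iso_iff_induced_embedding)
    from f[OF M(1)] show ?thesis
    proof (elim disjE exE conjE)
      assume "has_packing H k M"
      then show ?thesis using has_packing_induced_embedding[OF _ h] by blast
    next
      fix X
      assume X: "hitting_set H M X" "real (card X) \<le> f k"
      let ?Y = "{x \<in> verts G. g x \<in> X}"
      have "finite X" using X(1) M(1) finite_subset by (auto simp: hitting_set_def wf_graph_def)
      then have "card ?Y \<le> card X"
        using induced_embeddingD(1)[OF g]
        by (intro card_inj_on_le[of g]) (auto intro: inj_on_subset)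
      also have "card X \<le> nat \<lfloor>f k\<rfloor>" using X(2) by linarith
      finally show ?thesis using hitting_set_induced_embedding[OF X(1) g] by blast
    qed
  qed
  then show ?thesis using that by blast
qed

section \<open>Subdivisions and induced cycles\<close>

definition subdivide_edge :: "'a graph \<Rightarrow> 'a \<Rightarrow> 'a \<Rightarrow> 'a \<Rightarrow> 'a graph" where
  "subdivide_edge G x y z = (insert z (verts G), (edges G - {{x, y}}) \<union> {{x, z}, {z, y}})"

lemma verts_subdivide_edge: "verts (subdivide_edge G x y z) = insert z (verts G)"
  by (simp add: subdivide_edge_def verts_def)

lemma adj_subdivide_edge_iff:
  "adj (subdivide_edge G x y z) u v \<longleftrightarrow>
     adj G u v \<and> {u, v} \<noteq> {x, y} \<or> u = z \<and> v \<in> {x, y} \<or> v = z \<and> u \<in> {x, y}"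
  by (auto simp: subdivide_edge_def adj_def edges_def doubleton_eq_iff)

lemma subdivide_edge_commute: "subdivide_edge G x y z = subdivide_edge G y x z"
  by (auto simp: subdivide_edge_def insert_commute)

lemma wf_graph_subdivide_edge:
  assumes "wf_graph G" "adj G x y" "z \<notin> verts G"
  shows "wf_graph (subdivide_edge G x y z)"
proof -
  have "x \<in> verts G" "y \<in> verts G" using wf_graph_adjD[OF assms(1,2)] by auto
  moreover from this have "card {x, z} = 2" "card {z, y} = 2"
    using assms(3) by (auto simp: card_2_iff)
  ultimately show ?thesis
    using assms(1) by (auto simp: subdivide_edge_def wf_graph_def verts_def edges_def)
qed

lemma subdivision_of_map_graph_Inl: "subdivision_of H (map_graph Inl H)"
  unfolding map_graph_def by (rule subdivision_of.base)

lemma subdivision_of_subdivide_edge: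
  assumes "subdivision_of H G" "adj G x y" "z \<notin> verts G"
  shows "subdivision_of H (subdivide_edge G x y z)"
  using subdivision_of.step[of H "verts G" "edges G" x y z] assms
  by (simp add: subdivide_edge_def adj_def verts_def edges_def)

lemma subdivision_of_subdivide_induct [consumes 1, case_names base step]:
  assumes "subdivision_of H K"
    and "P (map_graph Inl H)"
    and "\<And>G x y z. \<lbrakk>subdivision_of H G; P G; adj G x y; z \<notin> verts G\<rbrakk> \<Longrightarrow> P (subdivide_edge G x y z)"
  shows "P K"
  using assms(1)
proof induction
  case base
  then show ?case using assms(2) by (simp add: map_graph_def)
next
  case (step V E x y z)
  then show ?case
    using assms(3)[of "(V, E)" x y z] by (simp add: subdivide_edge_def adj_def verts_def edges_def)
qed

lemma wf_graph_subdivision: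
  assumes "subdivision_of H K" "wf_graph H"
  shows "wf_graph K"
  using assms(1)
  by (induction rule: subdivision_of_subdivide_induct)
    (simp_all add: assms(2) wf_graph_map_graph wf_graph_subdivide_edge)

lemma verts_cycle_graph: "verts (cycle_graph n) = {..<n}"
  by (simp add: cycle_graph_def verts_def)

lemma adj_cycle_graph_iff:
  assumes "i < n" "j < n"
  shows "adj (cycle_graph n) i j \<longleftrightarrow> Suc i mod n = j \<or> Suc j mod n = i"
  using assms by (auto simp: adj_def cycle_graph_def edges_def doubleton_eq_iff)

lemma adj_cycle_graph_iff_Suc:
  assumes "i < n" "j < n"
  shows "adj (cycle_graph n) i j \<longleftrightarrow>
    Suc i = j \<or> Suc j = i \<or> Suc i = n \<and> j = 0 \<or> Suc j = n \<and> i = 0"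
  using assms by (auto simp: adj_cycle_graph_iff mod_Suc)

lemma induced_embedding_cycle_graph_rotate:
  assumes "n > 0"
  shows "induced_embedding (\<lambda>i. (i + c) mod n) (cycle_graph n) (cycle_graph n)"
proof -
  have cancel: "(i + c) mod n = (j + c) mod n \<longleftrightarrow> i mod n = j mod n" for i j
    using cong_add_rcancel_nat[of i c j n] by (simp add: cong_def)
  have "Suc ((i + c) mod n) mod n = (j + c) mod n \<longleftrightarrow> Suc i mod n = j mod n" for i j
    using cancel[of "Suc i" j] by (simp add: mod_Suc_eq)
  then show ?thesis
    using assms cancel
    by (auto simp: induced_embedding_def verts_cycle_graph adj_cycle_graph_iff inj_on_def)
qed

lemma induced_embedding_cycle_graph_subdivide_closing_edge:
  assumes wf: "wf_graph G" and f: "induced_embedding f (cycle_graph n) G"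
    and "3 \<le> n" "z \<notin> verts G"
  shows "induced_embedding (f(n := z)) (cycle_graph (Suc n)) (subdivide_edge G (f (n - 1)) (f 0) z)"
    (is "induced_embedding ?f _ ?L")
proof -
  have inj: "f i = f j \<longleftrightarrow> i = j" if "i < n" "j < n" for i j
    using induced_embeddingD(4)[OF f] that by (simp add: verts_cycle_graph)
  have fG: "f i \<in> verts G" if "i < n" for i
    using induced_embeddingD(2)[OF f] that by (auto simp: verts_cycle_graph)
  have fz: "f i \<noteq> z" "z \<noteq> f i" if "i < n" for i using fG[OF that] assms(4) by blast+
  have z_isolated: "\<not> adj G z v" "\<not> adj G v z" for v
    using wf_graph_adjD[OF wf] assms(4) by blast+
  have "adj ?L (?f i) (?f j) \<longleftrightarrow> adj (cycle_graph (Suc n)) i j" if "i < Suc n" "j < Suc n" for i j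
  proof -
    consider "i < n" "j < n" | "i = n" "j < n" | "i < n" "j = n" | "i = n" "j = n"
      using \<open>i < Suc n\<close> \<open>j < Suc n\<close> by linarith
    then show ?thesis
    proof cases
      case 1
      have "adj ?L (f i) (f j) \<longleftrightarrow> adj (cycle_graph n) i j \<and> {i, j} \<noteq> {n - 1, 0}"
        using 1 assms(3) induced_embeddingD(3)[OF f, of i j]
        by (simp add: fz adj_subdivide_edge_iff verts_cycle_graph doubleton_eq_iff inj)
      then show ?thesis
        using 1 assms(3) by (auto simp: adj_cycle_graph_iff_Suc doubleton_eq_iff)
    qed (use assms(3) in \<open>auto simp: fz inj z_isolated
        adj_subdivide_edge_iff adj_cycle_graph_iff_Suc\<close>)
  qed
  moreover have "inj_on ?f {..<Suc n}"
    by (auto simp: inj_on_def less_Suc_eq inj fz)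
  ultimately show ?thesis
    using fG by (auto simp: induced_embedding_def verts_cycle_graph verts_subdivide_edge)
qed

lemma has_induced_cycle_of_length_subdivide_cycle_edge:
  assumes "wf_graph G" "induced_embedding f (cycle_graph n) G" "3 \<le> n" "z \<notin> verts G" "k < n"
  shows "has_induced_cycle_of_length (subdivide_edge G (f k) (f (Suc k mod n)) z) (Suc n)"
proof -
  define g where "g = f \<circ> (\<lambda>i. (i + Suc k) mod n)"
  have "(n - 1 + Suc k) mod n = k" using \<open>k < n\<close> by simp
  then have ends: "g (n - 1) = f k" "g 0 = f (Suc k mod n)" by (simp_all add: g_def)
  have "induced_embedding g (cycle_graph n) G"
    unfolding g_def using assms(3)
    by (intro induced_embedding_comp[OF induced_embedding_cycle_graph_rotate assms(2)]) simp
  from induced_embedding_cycle_graph_subdivide_closing_edge[OF assms(1) this assms(3,4)]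
  show ?thesis unfolding has_induced_cycle_of_length_iff ends by blast
qed

lemma has_induced_cycle_of_length_subdivide_edge:
  assumes wf: "wf_graph G" and cycle: "has_induced_cycle_of_length G n" "3 \<le> n"
    and xy: "adj G x y" and z: "z \<notin> verts G"
  shows "\<exists>m\<ge>n. has_induced_cycle_of_length (subdivide_edge G x y z) m"
proof -
  obtain f where f: "induced_embedding f (cycle_graph n) G"
    using cycle(1) unfolding has_induced_cycle_of_length_iff by blast
  show ?thesis
  proof (cases "{x, y} \<subseteq> f ` {..<n}")
    case True
    then obtain i j where ij: "i < n" "j < n" "x = f i" "y = f j" by auto
    then have "adj (cycle_graph n) i j"
      using xy induced_embeddingD(3)[OF f] by (simp add: verts_cycle_graph)
    then consider "j = Suc i mod n" | "i = Suc j mod n"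
      using ij by (auto simp: adj_cycle_graph_iff)
    then have "has_induced_cycle_of_length (subdivide_edge G x y z) (Suc n)"
      using has_induced_cycle_of_length_subdivide_cycle_edge[OF wf f cycle(2) z] ij
      by cases (simp_all add: subdivide_edge_commute)
    then show ?thesis by (meson le_SucI order_refl)
  next
    case False
    have "f i \<noteq> z" if "i < n" for i
      using induced_embeddingD(2)[OF f] that z by (auto simp: verts_cycle_graph)
    then have "induced_embedding f (cycle_graph n) (subdivide_edge G x y z)"
      using f False
      by (auto simp: induced_embedding_def verts_cycle_graph verts_subdivide_edge
          adj_subdivide_edge_iff doubleton_eq_iff)
    then show ?thesis unfolding has_induced_cycle_of_length_iff by blast
  qed
qed

lemma has_induced_cycle_of_length_subdivision:
  assumes "subdivision_of H K" "wf_graph H" "has_induced_cycle_of_length H n" "3 \<le> n"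
  shows "\<exists>m\<ge>n. has_induced_cycle_of_length K m"
  using assms(1)
proof (induction rule: subdivision_of_subdivide_induct)
  case base
  have "induced_embedding Inl H (map_graph Inl H)"
    using assms(2) by (intro induced_embedding_map_graph) auto
  then show ?case
    using assms(3) induced_embedding_comp unfolding has_induced_cycle_of_length_iff by blast
next
  case (step G x y z)
  then obtain m where m: "n \<le> m" "has_induced_cycle_of_length G m" by blast
  have "wf_graph G" using step.hyps(1) assms(2) by (rule wf_graph_subdivision)
  then obtain m' where "m \<le> m'" "has_induced_cycle_of_length (subdivide_edge G x y z) m'"
    using has_induced_cycle_of_length_subdivide_edge[OF _ m(2) _ step.hyps(2,3)] m(1) assms(4)
    by auto
  then show ?case using m(1) order_trans by blast
qed

lemma induced_subdivision_contains_induced_cycle: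
  assumes "induced_subdivision H G S" "wf_graph H" "has_induced_cycle_of_length H n" "3 \<le> n"
  obtains m f where "n \<le> m" "induced_embedding f (cycle_graph m) G" "f ` {..<m} \<subseteq> S"
proof -
  obtain K g where K: "subdivision_of H K" "induced_embedding g K G" "g ` verts K = S"
    using assms(1) by (auto simp: induced_subdivision_iff)
  obtain m f where m: "n \<le> m" "induced_embedding f (cycle_graph m) K"
    using has_induced_cycle_of_length_subdivision[OF K(1) assms(2-4)]
    by (auto simp: has_induced_cycle_of_length_iff)
  have "(g \<circ> f) ` {..<m} \<subseteq> S"
    using induced_embeddingD(2)[OF m(2)] K(3) by (auto simp: verts_cycle_graph)
  then show ?thesis using that m induced_embedding_comp[OF m(2) K(2)] by blast
qed

section \<open>Minimum degree and girth\<close>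

definition min_degree_ge_two :: "'a graph \<Rightarrow> 'a set \<Rightarrow> bool" where
  "min_degree_ge_two G Z \<longleftrightarrow> (\<forall>p\<in>Z. \<exists>u\<in>Z. \<exists>v\<in>Z. u \<noteq> v \<and> adj G p u \<and> adj G p v)"

definition girth_ge_five :: "'a graph \<Rightarrow> 'a set \<Rightarrow> bool" where
  "girth_ge_five G Z \<longleftrightarrow>
     (\<forall>x\<in>Z. \<forall>y\<in>Z. \<forall>z\<in>Z. adj G x y \<longrightarrow> adj G y z \<longrightarrow> \<not> adj G z x) \<and>
     (\<forall>x\<in>Z. \<forall>y\<in>Z. \<forall>z\<in>Z. \<forall>w\<in>Z. x \<noteq> z \<longrightarrow> y \<noteq> w \<longrightarrow>
        adj G x y \<longrightarrow> adj G y z \<longrightarrow> adj G z w \<longrightarrow> \<not> adj G w x)"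

lemma min_degree_ge_twoE:
  assumes "min_degree_ge_two G Z" "p \<in> Z"
  obtains v where "v \<in> Z" "v \<noteq> u" "adj G p v"
  using assms unfolding min_degree_ge_two_def by metis

lemma girth_ge_five_no_triangle:
  assumes "girth_ge_five G Z" "x \<in> Z" "y \<in> Z" "z \<in> Z" "adj G x y" "adj G y z"
  shows "\<not> adj G z x"
  using assms unfolding girth_ge_five_def by blast

lemma girth_ge_five_no_four_cycle:
  assumes "girth_ge_five G Z" "x \<in> Z" "y \<in> Z" "z \<in> Z" "w \<in> Z" "x \<noteq> z" "y \<noteq> w"
    and "adj G x y" "adj G y z" "adj G z w"
  shows "\<not> adj G w x"
  using assms unfolding girth_ge_five_def by blast

lemma min_degree_ge_two_image_iff:
  assumes f: "induced_embedding f G K" and "Z \<subseteq> verts G"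
  shows "min_degree_ge_two K (f ` Z) \<longleftrightarrow> min_degree_ge_two G Z"
proof -
  have "adj K (f x) (f y) \<longleftrightarrow> adj G x y" "f x = f y \<longleftrightarrow> x = y" if "x \<in> Z" "y \<in> Z" for x y
    using induced_embeddingD(3,4)[OF f, of x y] assms(2) that by auto
  then show ?thesis by (simp add: min_degree_ge_two_def)
qed

lemma girth_ge_five_image_iff:
  assumes f: "induced_embedding f G K" and "Z \<subseteq> verts G"
  shows "girth_ge_five K (f ` Z) \<longleftrightarrow> girth_ge_five G Z"
proof -
  have "adj K (f x) (f y) \<longleftrightarrow> adj G x y" "f x = f y \<longleftrightarrow> x = y" if "x \<in> Z" "y \<in> Z" for x y
    using induced_embeddingD(3,4)[OF f, of x y] assms(2) that by auto
  then show ?thesis by (simp add: girth_ge_five_def)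
qed

lemma min_degree_ge_two_cycle_graph:
  assumes "3 \<le> n"
  shows "min_degree_ge_two (cycle_graph n) {..<n}"
  unfolding min_degree_ge_two_def
proof
  fix i
  assume "i \<in> {..<n}"
  then show "\<exists>u\<in>{..<n}. \<exists>v\<in>{..<n}. u \<noteq> v \<and> adj (cycle_graph n) i u \<and> adj (cycle_graph n) i v"
    using assms
    by (intro bexI[of _ "Suc i mod n"] bexI[of _ "if i = 0 then n - 1 else i - 1"])
      (auto simp: adj_cycle_graph_iff mod_Suc)
qed

lemma girth_ge_five_cycle_graph:
  assumes "5 \<le> n"
  shows "girth_ge_five (cycle_graph n) {..<n}"
  using assms by (auto simp: girth_ge_five_def adj_cycle_graph_iff_Suc)

lemma girth_ge_five_not_star_Un_independent:
  assumes deg: "min_degree_ge_two G Z" and girth: "girth_ge_five G Z"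
    and Z: "Z = insert b (A \<union> C)" and a: "a \<in> A"
    and star: "\<And>x. x \<in> A \<Longrightarrow> adj G b x"
    and indep: "\<And>x y. \<lbrakk>x \<in> C; y \<in> C\<rbrakk> \<Longrightarrow> \<not> adj G x y"
  shows False
proof -
  have star': "adj G x b" if "x \<in> A" for x using star[OF that] by (subst adj_commute)
  have ab: "a \<in> Z" "b \<in> Z" using Z a by auto
  obtain c where c: "c \<in> Z" "c \<noteq> b" "adj G a c" using deg ab(1) by (rule min_degree_ge_twoE)
  have "c \<notin> A"
    using girth_ge_five_no_triangle[OF girth c(1) ab(2,1)] star star' a c(3) by blast
  then have "c \<in> C" using c Z by blast
  obtain d where d: "d \<in> Z" "d \<noteq> a" "adj G c d" using deg c(1) by (rule min_degree_ge_twoE)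
  have "d \<noteq> b"
    using girth_ge_five_no_triangle[OF girth c(1) ab(2,1)] star a c(3) d(3) by blast
  then have "d \<in> A" using indep[OF \<open>c \<in> C\<close>] d Z by blast
  then show False
    using girth_ge_five_no_four_cycle[OF girth ab(2,1) c(1) d(1)] star star' a c d by blast
qed

lemma girth_ge_five_not_join_Un_independent:
  assumes deg: "min_degree_ge_two G Z" and girth: "girth_ge_five G Z" and Z: "Z = A \<union> B \<union> C"
    and ab: "a \<in> A" "b \<in> B"
    and join: "\<And>x y. \<lbrakk>x \<in> A; y \<in> B\<rbrakk> \<Longrightarrow> adj G x y"
    and indep: "\<And>x y. \<lbrakk>x \<in> C; y \<in> C\<rbrakk> \<Longrightarrow> \<not> adj G x y"
  shows False
proof -
  have join': "adj G y x" if "x \<in> A" "y \<in> B" for x y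
    using join[OF that] by (subst adj_commute)
  have "A = {a} \<or> B = {b}"
  proof (rule ccontr)
    assume "\<not> ?thesis"
    then obtain a' b' where ab': "a' \<in> A" "a' \<noteq> a" "b' \<in> B" "b' \<noteq> b" using ab by blast
    then have "a \<in> Z" "b \<in> Z" "a' \<in> Z" "b' \<in> Z" using ab Z by auto
    then show False
      using girth_ge_five_no_four_cycle[OF girth, of a b a' b'] ab ab' join join' by blast
  qed
  then show False
  proof
    assume "A = {a}"
    then have "Z = insert a (B \<union> C)" using Z by simp
    then show False
      using girth_ge_five_not_star_Un_independent[OF deg girth _ ab(2)] join ab(1) indep by blast
  next
    assume "B = {b}"
    then have "Z = insert b (A \<union> C)" using Z by simp
    then show False
      using girth_ge_five_not_star_Un_independent[OF deg girth _ ab(1)] join' ab(2) indep by blast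
  qed
qed

lemma girth_ge_five_common_index:
  fixes I :: "'a \<Rightarrow> 'b set"
  assumes deg: "min_degree_ge_two G Z" and girth: "girth_ge_five G Z" and "Z \<noteq> {}"
    and disjoint: "\<And>p q. \<lbrakk>p \<in> Z; q \<in> Z; p \<notin> X; I p \<inter> I q = {}\<rbrakk> \<Longrightarrow> adj G p q"
    and indep: "\<And>p q. \<lbrakk>p \<in> X; q \<in> X\<rbrakk> \<Longrightarrow> \<not> adj G p q"
    and single: "\<And>p. \<lbrakk>p \<in> Z; p \<notin> X\<rbrakk> \<Longrightarrow> \<exists>i. I p = {i}"
  shows "\<exists>i. \<forall>p\<in>Z. i \<in> I p"
proof -
  obtain y where y: "y \<in> Z" "y \<notin> X"
    using \<open>Z \<noteq> {}\<close> deg indep by (metis equals0I min_degree_ge_twoE)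
  then obtain i where i: "I y = {i}" using single by blast
  have "i \<in> I u" if "u \<in> Z" for u
  proof (rule ccontr)
    assume "i \<notin> I u"
    let ?A = "{p \<in> Z. p \<notin> X \<and> i \<in> I p}" and ?B = "{p \<in> Z. i \<notin> I p}"
      and ?C = "{p \<in> Z. p \<in> X \<and> i \<in> I p}"
    show False
    proof (rule girth_ge_five_not_join_Un_independent[OF deg girth])
      show "Z = ?A \<union> ?B \<union> ?C" by blast
      show "y \<in> ?A" using y i by simp
      show "u \<in> ?B" using \<open>u \<in> Z\<close> \<open>i \<notin> I u\<close> by simp
      show "adj G p q" if "p \<in> ?A" "q \<in> ?B" for p q
      proof (rule disjoint)
        obtain j where "I p = {j}" using single \<open>p \<in> ?A\<close> by blast
        then show "I p \<inter> I q = {}" using that by auto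
      qed (use that in auto)
      show "\<not> adj G p q" if "p \<in> ?C" "q \<in> ?C" for p q using indep that by blast
    qed
  qed
  then show ?thesis by blast
qed

section \<open>Subdividing every edge equally often\<close>

lemma subdivision_of_replace_edge_by_path:
  assumes "wf_graph H" "subdivision_of H (V, E)" and edge: "{p 0, y} \<in> E"
    and "inj_on p {..s}" "p ` {1..s} \<inter> V = {}"
  shows "subdivision_of H (V \<union> p ` {1..s},
    (E - {{p 0, y}}) \<union> (\<lambda>j. {p j, p (Suc j)}) ` {..<s} \<union> {{p s, y}})"
  using assms(4,5)
proof (induction s)
  case 0
  have "(E - {{p 0, y}}) \<union> {{p 0, y}} = E" using edge by blast
  then show ?case using assms(2) by simp
next
  case (Suc s)
  let ?G = "(V \<union> p ` {1..s}, (E - {{p 0, y}}) \<union> (\<lambda>j. {p j, p (Suc j)}) ` {..<s} \<union> {{p s, y}})"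
  have wf: "wf_graph (V, E)" using assms(2,1) by (rule wf_graph_subdivision)
  have EV: "e \<subseteq> V" if "e \<in> E" for e
    using wf that by (auto simp: wf_graph_def verts_def edges_def)
  have fresh: "p j \<notin> V" if "1 \<le> j" "j \<le> Suc s" for j
    using Suc.prems(2) that by (auto simp: disjoint_iff)
  have p_eq_iff: "p i = p j \<longleftrightarrow> i = j" if "i \<le> Suc s" "j \<le> Suc s" for i j
    using Suc.prems(1) that by (auto simp: inj_on_def)
  have "y \<in> V" "p 0 \<noteq> y"
    using wf_graph_adjD[OF wf, of "p 0" y] edge by (simp_all add: adj_def edges_def verts_def)
  then have y: "y \<noteq> p j" if "j \<le> Suc s" for j
    using fresh[of j] that by (cases "j = 0") auto
  have "p (Suc s) \<notin> verts ?G" using fresh p_eq_iff by (auto simp: verts_def)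
  moreover have "subdivision_of H ?G"
    using Suc.IH inj_on_subset[OF Suc.prems(1)] fresh by (fastforce simp: disjoint_iff)
  moreover have "adj ?G (p s) y" by (simp add: adj_def edges_def)
  ultimately have "subdivision_of H (subdivide_edge ?G (p s) y (p (Suc s)))"
    by (intro subdivision_of_subdivide_edge)
  moreover have "{p s, y} \<notin> E - {{p 0, y}}"
    using EV[of "{p s, y}"] fresh[of s] by (cases "s = 0") auto
  then have "subdivide_edge ?G (p s) y (p (Suc s)) = (V \<union> p ` {1..Suc s},
      (E - {{p 0, y}}) \<union> (\<lambda>j. {p j, p (Suc j)}) ` {..<Suc s} \<union> {{p (Suc s), y}})"
    using y by (auto simp: subdivide_edge_def verts_def edges_def
        atLeastAtMostSuc_conv lessThan_Suc doubleton_eq_iff)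
  ultimately show ?case by simp
qed

locale edge_enumeration =
  fixes H :: "'a graph" and a b :: "nat \<Rightarrow> 'a" and q :: nat
  assumes wf_H: "wf_graph H"
    and inj_edges: "inj_on (\<lambda>t. {a t, b t}) {..<q}"
    and edges_H: "edges H = (\<lambda>t. {a t, b t}) ` {..<q}"

lemma ex_edge_enumeration:
  assumes "wf_graph H"
  obtains a b q where "edge_enumeration H a b q"
proof -
  have "edges H \<subseteq> Pow (verts H)" using assms by (auto simp: wf_graph_def)
  then have "finite (edges H)" using assms by (meson finite_Pow_iff finite_subset wf_graph_def)
  then obtain q and e :: "nat \<Rightarrow> 'a set" where e: "edges H = e ` {..<q}" "inj_on e {..<q}"
    using finite_imp_nat_seg_image_inj_on[of "edges H"] by (auto simp: lessThan_def)
  have "\<exists>x y. e t = {x, y}" if "t < q" for t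
  proof -
    have "card (e t) = 2" using assms e(1) that by (simp add: wf_graph_def)
    then show ?thesis by (auto simp: card_2_iff)
  qed
  then obtain a b where ab: "\<And>t. t < q \<Longrightarrow> e t = {a t, b t}" by metis
  have "edge_enumeration H a b q"
  proof
    show "inj_on (\<lambda>t. {a t, b t}) {..<q}" using e(2) ab by (simp add: inj_on_def)
    show "edges H = (\<lambda>t. {a t, b t}) ` {..<q}" unfolding e(1) using ab by (intro image_cong) auto
  qed (fact assms)
  then show ?thesis using that by blast
qed

definition mid :: "nat \<Rightarrow> nat \<Rightarrow> 'a + nat" where
  "mid t j = Inr (prod_encode (t, j))"

lemma mid_eq_iff [simp]: "mid t j = mid t' j' \<longleftrightarrow> t = t' \<and> j = j'"
  by (simp add: mid_def)

lemma mid_neq_Inl [simp]: "mid t j \<noteq> Inl x" "Inl x \<noteq> mid t j"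
  by (simp_all add: mid_def)

locale uniform_subdivision = edge_enumeration H a b q
  for H :: "'a graph" and a b :: "nat \<Rightarrow> 'a" and q :: nat +
  fixes r :: nat
  assumes r_pos: "0 < r"
begin

definition path :: "nat \<Rightarrow> nat \<Rightarrow> 'a + nat" where
  "path t j = (if j = 0 then Inl (a t) else if j \<le> r then mid t j else Inl (b t))"

definition path_edges :: "nat \<Rightarrow> ('a + nat) set set" where
  "path_edges t = (\<lambda>j. {path t j, path t (Suc j)}) ` {..r}"

definition path_interior :: "nat \<Rightarrow> ('a + nat) set" where
  "path_interior t = mid t ` {1..r}"

definition subdivided_upto :: "nat \<Rightarrow> ('a + nat) graph" where
  "subdivided_upto m = (Inl ` verts H \<union> (\<Union>t<m. path_interior t),
     (\<Union>t<m. path_edges t) \<union> (\<lambda>t. {Inl (a t), Inl (b t)}) ` {m..<q})"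

definition subdivided :: "('a + nat) graph" where
  "subdivided = subdivided_upto q"

lemma path_eq_mid_iff: "path t j = mid t' j' \<longleftrightarrow> t' = t \<and> j' = j \<and> 1 \<le> j \<and> j \<le> r"
  by (auto simp: path_def)

lemma path_edges_meet_interior: "e \<in> path_edges t \<Longrightarrow> e \<inter> path_interior t \<noteq> {}"
  using r_pos by (fastforce simp: path_edges_def path_interior_def path_def)

lemma subdivided_upto_Suc:
  assumes "m < q"
  shows "subdivided_upto (Suc m) = (verts (subdivided_upto m) \<union> path_interior m,
    (edges (subdivided_upto m) - {{Inl (a m), Inl (b m)}}) \<union> path_edges m)"
proof -
  let ?e = "{Inl (a m), Inl (b m)}"
  let ?R = "(\<Union>t<m. path_edges t) \<union> (\<lambda>t. {Inl (a t), Inl (b t)}) ` {Suc m..<q}"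
  have "?e \<notin> path_edges t" for t
    using path_edges_meet_interior[of ?e t] by (auto simp: path_interior_def)
  moreover have "{a m, b m} \<noteq> {a t, b t}" if "t \<in> {Suc m..<q}" for t
    using inj_onD[OF inj_edges, of m t] that by auto
  then have "?e \<noteq> {Inl (a t), Inl (b t)}" if "t \<in> {Suc m..<q}" for t
    using that by (simp add: doubleton_eq_iff)
  ultimately have "?e \<notin> ?R" by blast
  moreover have "{m..<q} = insert m {Suc m..<q}" using assms by auto
  then have "edges (subdivided_upto m) = insert ?e ?R" by (simp add: subdivided_upto_def edges_def)
  ultimately have "edges (subdivided_upto m) - {?e} = ?R" by simp
  then show ?thesis by (simp add: subdivided_upto_def verts_def lessThan_Suc Un_ac)
qed

lemma subdivision_of_subdivided_upto: "m \<le> q \<Longrightarrow> subdivision_of H (subdivided_upto m)"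
proof (induction m)
  case 0
  have "subdivided_upto 0 = map_graph Inl H"
    by (auto simp: subdivided_upto_def map_graph_def edges_H atLeast0LessThan image_image)
  then show ?case using subdivision_of_map_graph_Inl by metis
next
  case (Suc m)
  let ?V = "verts (subdivided_upto m)" and ?E = "edges (subdivided_upto m)"
  have interior: "path m ` {1..r} = path_interior m"
    by (simp add: path_def path_interior_def)
  have ends: "path m 0 = Inl (a m)" "path m (Suc r) = Inl (b m)"
    by (simp_all add: path_def)
  have "subdivision_of H (?V \<union> path m ` {1..r}, (?E - {{path m 0, path m (Suc r)}}) \<union>
      (\<lambda>j. {path m j, path m (Suc j)}) ` {..<r} \<union> {{path m r, path m (Suc r)}})"
    using wf_H
  proof (rule subdivision_of_replace_edge_by_path)
    show "subdivision_of H (?V, ?E)" using Suc by (simp add: verts_def edges_def)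
    show "{path m 0, path m (Suc r)} \<in> ?E"
      using Suc.prems by (auto simp: ends subdivided_upto_def edges_def)
    show "inj_on (path m) {..r}" by (auto simp: inj_on_def path_def split: if_splits)
    show "path m ` {1..r} \<inter> ?V = {}"
      unfolding interior by (auto simp: subdivided_upto_def verts_def path_interior_def)
  qed
  moreover have "path_edges m =
      (\<lambda>j. {path m j, path m (Suc j)}) ` {..<r} \<union> {{path m r, path m (Suc r)}}"
    by (simp add: path_edges_def lessThan_Suc flip: lessThan_Suc_atMost)
  ultimately show ?case
    using Suc.prems by (simp add: subdivided_upto_Suc ends Un_assoc flip: interior)
qed

lemma subdivision_of_subdivided: "subdivision_of H subdivided"
  by (simp add: subdivided_def subdivision_of_subdivided_upto)

lemma wf_subdivided: "wf_graph subdivided"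
  using subdivision_of_subdivided wf_H by (rule wf_graph_subdivision)

lemma mid_in_subdivided_iff: "mid t j \<in> verts subdivided \<longleftrightarrow> t < q \<and> 1 \<le> j \<and> j \<le> r"
  by (auto simp: subdivided_def subdivided_upto_def verts_def path_interior_def image_iff)

lemma adj_subdivided_iff:
  "adj subdivided u v \<longleftrightarrow> (\<exists>t<q. \<exists>j\<le>r. {u, v} = {path t j, path t (Suc j)})"
  by (auto simp: adj_def subdivided_def subdivided_upto_def edges_def path_edges_def)

lemma adj_subdivided_midD:
  assumes "adj subdivided (mid t j) w"
  shows "w = path t (j - 1) \<or> w = path t (Suc j)"
proof -
  obtain t' j' where "{mid t j, w} = {path t' j', path t' (Suc j')}"
    using assms adj_subdivided_iff by blast
  then have "path t' j' = mid t j \<and> w = path t' (Suc j') \<or>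
      path t' (Suc j') = mid t j \<and> w = path t' j'"
    by (metis doubleton_eq_iff)
  then show ?thesis by (auto simp: path_eq_mid_iff)
qed

lemma min_degree_ge_two_contains_path_interior:
  assumes "Z \<noteq> {}" and deg: "min_degree_ge_two subdivided Z"
  shows "\<exists>t<q. path_interior t \<subseteq> Z"
proof -
  obtain u v where "u \<in> Z" "v \<in> Z" "adj subdivided u v"
    using assms by (metis equals0I min_degree_ge_twoE)
  then obtain t where t: "t < q" "{u, v} \<in> path_edges t" "{u, v} \<subseteq> Z"
    by (auto simp: subdivided_def subdivided_upto_def adj_def edges_def)
  then obtain i where i: "1 \<le> i" "i \<le> r" "mid t i \<in> Z"
    using path_edges_meet_interior[OF t(2)] by (auto simp: path_interior_def)
  have neighbours: "path t (j - 1) \<in> Z" "path t (Suc j) \<in> Z" if "mid t j \<in> Z" for j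
    using deg that adj_subdivided_midD[of t j] unfolding min_degree_ge_two_def by metis+
  have up: "j \<le> r \<longrightarrow> mid t j \<in> Z" if "i \<le> j" for j
    using that
  proof (induction rule: dec_induct)
    case base
    then show ?case using i by blast
  next
    case (step j)
    then show ?case using neighbours(2)[of j] by (auto simp: path_def)
  qed
  have down: "1 \<le> j \<longrightarrow> mid t j \<in> Z" if "j \<le> i" for j
    using that
  proof (induction rule: inc_induct)
    case base
    then show ?case using i by blast
  next
    case (step j)
    then show ?case using neighbours(1)[of "Suc j"] i(2) by (auto simp: path_def)
  qed
  have "path_interior t \<subseteq> Z"
    using up down by (auto simp: path_interior_def) (metis nle_le)
  then show ?thesis using t(1) by blast
qed

end

section \<open>Crossing copies\<close>

text \<open>Crossings sit at even positions, so that no two of them are adjacent in a copy. A vertex of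
  the crossing graph is an equivalence class, and \<open>fst ` x\<close> is the set of copies containing \<open>x\<close>.\<close>

definition identified :: "((nat \<times> ('a + nat)) \<times> (nat \<times> ('a + nat))) set" where
  "identified = {((i, v), (j, w)).
     i = j \<and> v = w \<or> (\<exists>t. v = mid t (2 * j) \<and> w = mid t (2 * i))}"

lemma equiv_identified: "equiv UNIV identified"
  by (auto simp: identified_def intro!: equivI refl_onI symI transI)

definition copy :: "nat \<Rightarrow> 'a + nat \<Rightarrow> (nat \<times> ('a + nat)) set" where
  "copy i v = identified `` {(i, v)}"

lemma copy_eq_iff:
  "copy i v = copy j w \<longleftrightarrow> i = j \<and> v = w \<or> (\<exists>t. v = mid t (2 * j) \<and> w = mid t (2 * i))"
  unfolding copy_def eq_equiv_class_iff[OF equiv_identified UNIV_I UNIV_I]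
  by (simp add: identified_def)

lemma inj_copy: "inj (copy i)"
  by (auto simp: inj_def copy_eq_iff)

lemma mem_copy_iff:
  "(j, w) \<in> copy i v \<longleftrightarrow> i = j \<and> v = w \<or> (\<exists>t. v = mid t (2 * j) \<and> w = mid t (2 * i))"
  by (simp add: copy_def identified_def)

lemma index_mem_copy: "i \<in> fst ` copy i v"
  using mem_copy_iff[of i v i v] by force

definition shared :: "(nat \<times> ('a + nat)) set \<Rightarrow> bool" where
  "shared x \<longleftrightarrow> \<not> is_singleton x"

lemma shared_copyE:
  assumes "shared (copy i v)"
  obtains t l where "v = mid t (2 * l)"
proof (rule ccontr)
  assume "\<not> thesis"
  then have "copy i v = {(i, v)}" using that by (auto simp: copy_def identified_def)
  then show False using assms by (simp add: shared_def)
qed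

lemma card_indices_copy_le: "card (fst ` copy i v) \<le> 2"
proof -
  have "\<exists>l. fst ` copy i v \<subseteq> {i, l}"
    by (cases "\<exists>t l. v = mid t (2 * l)") (auto simp: copy_def identified_def)
  then obtain l where "fst ` copy i v \<subseteq> {i, l}" ..
  then have "card (fst ` copy i v) \<le> card {i, l}" by (rule card_mono[rotated]) simp
  also have "\<dots> \<le> 2" by (simp add: card_insert_if)
  finally show ?thesis .
qed

locale crossing_copies = uniform_subdivision H a b q "2 * n"
  for H :: "'a graph" and a b :: "nat \<Rightarrow> 'a" and q n :: nat
begin

definition crossing_adj :: "(nat \<times> ('a + nat)) set \<Rightarrow> (nat \<times> ('a + nat)) set \<Rightarrow> bool" where
  "crossing_adj x y \<longleftrightarrow>
     (\<exists>i\<in>{1..n}. \<exists>v w. x = copy i v \<and> y = copy i w \<and> adj subdivided v w) \<or>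
     fst ` x \<inter> fst ` y = {} \<and> \<not> (shared x \<and> shared y)"

definition crossing_graph :: "(nat \<times> ('a + nat)) set graph" where
  "crossing_graph = graph_of_rel (\<Union>i\<in>{1..n}. copy i ` verts subdivided) crossing_adj"

lemma verts_crossing_graph: "verts crossing_graph = (\<Union>i\<in>{1..n}. copy i ` verts subdivided)"
  by (simp add: crossing_graph_def verts_graph_of_rel)

lemma adj_crossing_graph_iff:
  "adj crossing_graph x y \<longleftrightarrow>
     x \<in> verts crossing_graph \<and> y \<in> verts crossing_graph \<and> crossing_adj x y"
proof -
  have "symp crossing_adj"
    using adj_commute[of subdivided] unfolding crossing_adj_def by (intro sympI) blast
  then show ?thesis by (simp add: crossing_graph_def adj_graph_of_rel_iff verts_graph_of_rel)
qed

lemma wf_crossing_graph: "wf_graph crossing_graph"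
proof -
  have "\<not> crossing_adj (copy i v) (copy i v)" for i v
    using wf_graph_adjD(1)[OF wf_subdivided] index_mem_copy[of i v] injD[OF inj_copy]
    unfolding crossing_adj_def by blast
  moreover have "finite (verts subdivided)" using wf_subdivided by (simp add: wf_graph_def)
  ultimately show ?thesis
    unfolding crossing_graph_def by (intro wf_graph_graph_of_rel) (auto simp: irreflp_on_def)
qed

lemma mem_copy_if_index:
  assumes "x \<in> verts crossing_graph" "i \<in> fst ` x"
  shows "i \<in> {1..n}" "x \<in> copy i ` verts subdivided"
proof -
  obtain j v where j: "j \<in> {1..n}" "v \<in> verts subdivided" "x = copy j v"
    using assms(1) by (auto simp: verts_crossing_graph)
  obtain w where "(i, w) \<in> copy j v" using assms(2) j(3) by force
  then consider "i = j" "w = v" | t where "v = mid t (2 * i)" "w = mid t (2 * j)"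
    by (auto simp: mem_copy_iff)
  then have "i \<in> {1..n} \<and> w \<in> verts subdivided"
    using j by cases (auto simp: mid_in_subdivided_iff)
  moreover have "copy i w = x"
    using \<open>(i, w) \<in> copy j v\<close> j(3) by (auto simp: mem_copy_iff copy_eq_iff)
  ultimately show "i \<in> {1..n}" "x \<in> copy i ` verts subdivided" by auto
qed

lemma not_adj_even_mids: "\<not> adj subdivided (mid t (2 * l)) (mid t' (2 * l'))"
proof
  assume "adj subdivided (mid t (2 * l)) (mid t' (2 * l'))"
  from adj_subdivided_midD[OF this]
  have "path t (2 * l - 1) = mid t' (2 * l') \<or> path t (Suc (2 * l)) = mid t' (2 * l')" by auto
  then show False unfolding path_eq_mid_iff by presburger
qed

lemma not_adj_shared:
  assumes "shared x" "shared y"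
  shows "\<not> adj crossing_graph x y"
  using assms not_adj_even_mids unfolding adj_crossing_graph_iff crossing_adj_def
  by (metis shared_copyE)

lemma crossing_adj_copy_iff:
  assumes "i \<in> {1..n}"
  shows "crossing_adj (copy i v) (copy i w) \<longleftrightarrow> adj subdivided v w"
proof
  assume "crossing_adj (copy i v) (copy i w)"
  moreover have "fst ` copy i v \<inter> fst ` copy i w \<noteq> {}"
    using index_mem_copy[of i v] index_mem_copy[of i w] by blast
  ultimately obtain j v' w' where j: "copy i v = copy j v'" "copy i w = copy j w'"
      "adj subdivided v' w'"
    unfolding crossing_adj_def by blast
  from j(1,2) consider "v = v'" "w = w'" | t t' where "v' = mid t (2 * i)" "w' = mid t' (2 * i)"
    by (auto simp: copy_eq_iff)
  then show "adj subdivided v w"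
    using j(3) not_adj_even_mids by cases auto
next
  assume "adj subdivided v w"
  then show "crossing_adj (copy i v) (copy i w)" using assms unfolding crossing_adj_def by blast
qed

lemma induced_embedding_copy:
  assumes "i \<in> {1..n}"
  shows "induced_embedding (copy i) subdivided crossing_graph"
proof -
  have "inj_on (copy i) (verts subdivided)" using inj_copy by (rule inj_on_subset) simp
  moreover have "copy i ` verts subdivided \<subseteq> verts crossing_graph"
    using assms unfolding verts_crossing_graph by blast
  ultimately show ?thesis
    using crossing_adj_copy_iff[OF assms]
    by (auto simp: induced_embedding_def adj_crossing_graph_iff)
qed

lemma min_degree_ge_two_girth_ge_five_contains_path_interior:
  assumes "Z \<subseteq> verts crossing_graph" "Z \<noteq> {}"
    and deg: "min_degree_ge_two crossing_graph Z" and girth: "girth_ge_five crossing_graph Z"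
  shows "\<exists>i\<in>{1..n}. \<exists>t<q. copy i ` path_interior t \<subseteq> Z"
proof -
  have "\<exists>i. \<forall>x\<in>Z. i \<in> fst ` x"
  proof (rule girth_ge_five_common_index[OF deg girth assms(2), of "Collect shared" "(`) fst"])
    show "adj crossing_graph x y"
      if "x \<in> Z" "y \<in> Z" "x \<notin> Collect shared" "fst ` x \<inter> fst ` y = {}" for x y
      using that assms(1) by (auto simp: adj_crossing_graph_iff crossing_adj_def)
    show "\<exists>i. fst ` x = {i}" if "x \<notin> Collect shared" for x
      using that by (auto simp: shared_def is_singleton_def)
    show "\<not> adj crossing_graph x y" if "x \<in> Collect shared" "y \<in> Collect shared" for x y
      using that not_adj_shared by simp
  qed
  then obtain i where i: "\<And>x. x \<in> Z \<Longrightarrow> i \<in> fst ` x" by blast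
  let ?Z = "{v \<in> verts subdivided. copy i v \<in> Z}"
  have "i \<in> {1..n} \<and> x \<in> copy i ` verts subdivided" if "x \<in> Z" for x
    using mem_copy_if_index[of x i] i[OF that] assms(1) that by blast
  then have "i \<in> {1..n}" and "Z \<subseteq> copy i ` verts subdivided" using assms(2) by auto
  then have Z: "Z = copy i ` ?Z" by blast
  then have "min_degree_ge_two subdivided ?Z"
    using deg min_degree_ge_two_image_iff[OF induced_embedding_copy[OF \<open>i \<in> {1..n}\<close>], of ?Z] by simp
  then obtain t where "t < q" "path_interior t \<subseteq> ?Z"
    using min_degree_ge_two_contains_path_interior[of ?Z] Z assms(2) by blast
  then show ?thesis using \<open>i \<in> {1..n}\<close> by blast
qed

lemma induced_subdivision_contains_path_interior:
  assumes "induced_subdivision H crossing_graph S" "has_induced_cycle_of_length H m" "5 \<le> m"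
  shows "\<exists>i\<in>{1..n}. \<exists>t<q. copy i ` path_interior t \<subseteq> S"
proof -
  obtain k f where k: "m \<le> k" and f: "induced_embedding f (cycle_graph k) crossing_graph"
    and fS: "f ` {..<k} \<subseteq> S"
    using induced_subdivision_contains_induced_cycle[OF assms(1) wf_H assms(2)] assms(3) by auto
  have "min_degree_ge_two crossing_graph (f ` {..<k})" "girth_ge_five crossing_graph (f ` {..<k})"
    using min_degree_ge_two_image_iff[OF f] girth_ge_five_image_iff[OF f] k assms(3)
    by (simp_all add: verts_cycle_graph min_degree_ge_two_cycle_graph girth_ge_five_cycle_graph)
  moreover have "f ` {..<k} \<subseteq> verts crossing_graph" "f ` {..<k} \<noteq> {}"
    using induced_embeddingD(2)[OF f] k assms(3)
    by (auto simp: verts_cycle_graph lessThan_empty_iff)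
  ultimately show ?thesis
    using min_degree_ge_two_girth_ge_five_contains_path_interior fS by (meson subset_trans)
qed

lemma path_interiors_cross:
  assumes "i \<in> {1..n}" "j \<in> {1..n}"
  shows "copy i ` path_interior t \<inter> copy j ` path_interior t \<noteq> {}"
proof -
  have "copy i (mid t (2 * j)) = copy j (mid t (2 * i))" by (simp add: copy_eq_iff)
  moreover have "mid t (2 * j) \<in> path_interior t" "mid t (2 * i) \<in> path_interior t"
    using assms by (auto simp: path_interior_def)
  ultimately show ?thesis by blast
qed

lemma not_has_packing:
  assumes "has_induced_cycle_of_length H m" "5 \<le> m"
  shows "\<not> has_packing H (Suc q) crossing_graph"
proof
  assume "has_packing H (Suc q) crossing_graph"
  then obtain S where S: "\<And>k. k < Suc q \<Longrightarrow> induced_subdivision H crossing_graph (S k)"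
    and disjoint: "disjoint_family_on S {..<Suc q}"
    unfolding has_packing_def by blast
  have "\<exists>i t. i \<in> {1..n} \<and> t < q \<and> copy i ` path_interior t \<subseteq> S k" if "k < Suc q" for k
    using induced_subdivision_contains_path_interior[OF S[OF that] assms] by blast
  then obtain I T where I: "\<And>k. k < Suc q \<Longrightarrow> I k \<in> {1..n}" and T: "\<And>k. k < Suc q \<Longrightarrow> T k < q"
    and interior: "\<And>k. k < Suc q \<Longrightarrow> copy (I k) ` path_interior (T k) \<subseteq> S k"
    by metis
  have "T ` {..<Suc q} \<subseteq> {..<q}" using T by auto
  then have "\<not> inj_on T {..<Suc q}" using card_inj_on_le[of T "{..<Suc q}" "{..<q}"] by auto
  then obtain k l where kl: "k < Suc q" "l < Suc q" "k \<noteq> l" "T k = T l" by (auto simp: inj_on_def)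
  then have "S k \<inter> S l \<noteq> {}"
    using path_interiors_cross[OF I[OF kl(1)] I[OF kl(2)], of "T k"]
      interior[OF kl(1)] interior[OF kl(2)] by auto
  then show False using disjoint_family_onD[OF disjoint, of k l] kl by simp
qed

lemma hitting_set_card_ge:
  assumes "hitting_set H crossing_graph X"
  shows "n \<le> 2 * card X"
proof -
  have X: "X \<subseteq> verts crossing_graph" using assms by (simp add: hitting_set_def)
  then have fin: "finite X" using wf_crossing_graph finite_subset by (auto simp: wf_graph_def)
  have "{1..n} \<subseteq> (\<Union>x\<in>X. fst ` x)"
  proof
    fix i
    assume i: "i \<in> {1..n}"
    have "induced_subdivision H crossing_graph (copy i ` verts subdivided)"
      using subdivision_of_subdivided induced_embedding_copy[OF i]
      unfolding induced_subdivision_iff by blast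
    then obtain v where "copy i v \<in> X" using assms by (auto simp: hitting_set_def)
    then show "i \<in> (\<Union>x\<in>X. fst ` x)" using index_mem_copy by (rule UN_I)
  qed
  moreover have "finite (fst ` x)" if "x \<in> X" for x
  proof -
    have "fst ` x \<subseteq> {1..n}" using mem_copy_if_index(1) X that by blast
    then show ?thesis by (rule finite_subset) simp
  qed
  ultimately have "card {1..n} \<le> card (\<Union>x\<in>X. fst ` x)" using fin by (intro card_mono) auto
  also have "\<dots> \<le> (\<Sum>x\<in>X. card (fst ` x))" using fin by (rule card_UN_le)
  also have "\<dots> \<le> (\<Sum>x\<in>X. 2)"
  proof (rule sum_mono)
    fix x
    assume "x \<in> X"
    then obtain i v where "x = copy i v" using X by (auto simp: verts_crossing_graph)
    then show "card (fst ` x) \<le> 2" by (simp add: card_indices_copy_le)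
  qed
  finally show ?thesis by simp
qed

end

theorem mainTheorem4:
  fixes H :: "'a graph"
  assumes "wf_graph H"
    and "\<exists>n\<ge>5. has_induced_cycle_of_length H n"
  shows "\<not> induced_EP_property H"
proof
  assume "induced_EP_property H"
  obtain m where m: "has_induced_cycle_of_length H m" "5 \<le> m" using assms(2) by blast
  obtain a b q where "edge_enumeration H a b q" using ex_edge_enumeration[OF assms(1)] .
  then interpret edge_enumeration H a b q .
  obtain N where N: "\<And>G :: (nat \<times> ('a + nat)) set graph. wf_graph G \<Longrightarrow>
      has_packing H (Suc q) G \<or> (\<exists>X. hitting_set H G X \<and> card X \<le> N)"
    using induced_EP_property_bound[OF \<open>induced_EP_property H\<close>, of "Suc q"] by blast
  interpret crossing_copies H a b q "2 * N + 1" by unfold_locales simp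
  obtain X where "hitting_set H crossing_graph X" "card X \<le> N"
    using N[OF wf_crossing_graph] not_has_packing[OF m] by blast
  then show False using hitting_set_card_ge[of X] by simp
qed

end
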